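(* Let $H:T^*Q\to\mathbb{R}$ be a continuously differentiable Hamiltonian with exact discrete right Hamiltonian $H_d^{+,E}$, and let $H_d^+:T^*Q\to\mathbb{R}$ (depending on the time-step $h$) be a discrete right Hamiltonian that approximates $H_d^{+,E}$ to order $r$, i.e. $$H_d^+(q_0,p_1;h)=H_d^{+,E}(q_0,p_1;h)+\mathcal{O}(h^{r+1}).$$ Then the discrete map $\tilde F^h_{H_d^+}:(q_k,p_k)\mapsto(q_{k+1},p_{k+1})$ generated by $H_d^+$, viewed as a one-step method for Hamilton's equations of $H$, is order $r$ accurate.
   Context: $Q$ is a finite-dimensional configuration manifold; everything is local, in coordinates $(q,p)$ on $T^*Q$. The exact discrete right Hamiltonian is $$H_d^{+,E}(q_0,p_1;h)=p_1^Tq(h)-\int_0^h\left[p(t)^T\dot q(t)-H(q(t),p(t))\right]dt,$$ where $(q(t),p(t))$ is the solution of Hamilton's equations $\dot q=\partial H/\partial p$, $\dot p=-\partial H/\partial q$ with boundary conditions $q(0)=q_0$, $p(h)=p_1$ (equivalently, the extremal value of the expression over curves in $T^*Q$ satisfying these boundary conditions). This boundary-value problem is assumed to be (locally) uniquely solvable. The map generated by $H_d^{+,E}$ is the time-$h$ Hamiltonian flow. A discrete right Hamiltonian $H_d^+(q_k,p_{k+1};h)$ is a Type II generating function. It generates the map $\tilde F^h_{H_d^+}:(q_k,p_k)\mapsto(q_{k+1},p_{k+1})$ defined implicitly by $$q_{k+1}=D_2H_d^+(q_k,p_{k+1};h),\qquad p_k=D_1H_d^+(q_k,p_{k+1};h).$$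 Equivalently, $\tilde F^h_{H_d^+}=\mathbb{F}^+H_d^+\circ(\mathbb{F}^-H_d^+)^{-1}$ with discrete Legendre transforms $\mathbb{F}^+H_d^+(q_k,p_{k+1})=(D_2H_d^+(q_k,p_{k+1}),p_{k+1})$ and $\mathbb{F}^-H_d^+(q_k,p_{k+1})=(q_k,D_1H_d^+(q_k,p_{k+1}))$. The discrete Legendre transforms of $H_d^+$ and $H_d^{+,E}$ are assumed to be locally invertible, and they, their inverses and the generating functions are assumed to be sufficiently regular in $(q,p,h)$ (of class $C^r$, with $r\geq 1$). The relation $H_d^+=H_d^{+,E}+\mathcal{O}(h^{r+1})$ means that there is a continuously differentiable function $e(q_0,p_1,h)$, bounded together with its first derivatives on compact sets, with $H_d^+(q_0,p_1;h)=H_d^{+,E}(q_0,p_1;h)+h^{r+1}e(q_0,p_1,h)$. A one-step method $\Phi_h$ is order $r$ accurate if $\Phi_h(q_0,p_0)=\varphi_h(q_0,p_0)+\mathcal{O}(h^{r+1})$ as $h\to 0$, uniformly for $(q_0,p_0)$ in compact sets, where $\varphi_h$ is the time-$h$ flow of Hamilton's equations. *)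

theory Defs
  imports "HOL-Analysis.Analysis"
begin

text \<open>
  Points of the phase space are pairs \<open>(q, p)\<close> of canonical coordinates on a local patch of the
  cotangent bundle; a patch is an open set \<open>P\<close> of such pairs. A Type II generating function is a
  map \<open>G\<close> with \<open>G h (q\<^sub>0, p\<^sub>1)\<close> the value at step size \<open>h\<close>. Step sizes are non-negative, so the set
  \<open>D\<close> of all \<open>((q\<^sub>0, p\<^sub>1), h)\<close> under consideration is open relative to the closed half-space
  \<open>h \<ge> 0\<close>, and derivatives on \<open>D\<close> are taken within \<open>D\<close> (one-sided in \<open>h\<close> at \<open>h = 0\<close>).
\<close>

type_synonym 'n phase = "(real^'n) \<times> (real^'n)"

definition half_space :: "('n::finite phase \<times> real) set" where
  "half_space = UNIV \<times> {0..}"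

text \<open>
  Class \<open>C\<^sup>k\<close> on a set. The notion is meant for sets on which derivatives within the set are
  unique, such as open sets and relatively open subsets of a half-space. Continuity of all
  directional derivatives \<open>\<lambda>x. f' x v\<close> amounts, in finite dimension, to continuity in operator norm.
\<close>

primrec Ck_on :: "nat \<Rightarrow> ('a::real_normed_vector \<Rightarrow> 'b::real_normed_vector) \<Rightarrow> 'a set \<Rightarrow> bool" where
  "Ck_on 0 f S \<longleftrightarrow> continuous_on S f"
| "Ck_on (Suc k) f S \<longleftrightarrow>
     (\<exists>f'. (\<forall>x\<in>S. (f has_derivative f' x) (at x within S)) \<and> (\<forall>v. Ck_on k (\<lambda>x. f' x v) S))"

definition gradient :: "('a::real_inner \<Rightarrow> real) \<Rightarrow> 'a \<Rightarrow> 'a" where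
  "gradient f x = (THE D. GDERIV f x :> D)"

definition D1 :: "('n::finite phase \<Rightarrow> real) \<Rightarrow> 'n phase \<Rightarrow> real^'n" where
  "D1 f z = gradient (\<lambda>x. f (x, snd z)) (fst z)"

definition D2 :: "('n::finite phase \<Rightarrow> real) \<Rightarrow> 'n phase \<Rightarrow> real^'n" where
  "D2 f z = gradient (\<lambda>y. f (fst z, y)) (snd z)"

definition hamilton_solution ::
  "('n::finite phase \<Rightarrow> real) \<Rightarrow> 'n phase set \<Rightarrow> real \<Rightarrow> (real \<Rightarrow> real^'n) \<Rightarrow> (real \<Rightarrow> real^'n) \<Rightarrow> bool"
where
  "hamilton_solution H P h q p \<longleftrightarrow>
     (\<forall>t\<in>{0..h}. (q t, p t) \<in> P \<and>
        (q has_vector_derivative D2 H (q t, p t)) (at t within {0..h}) \<and>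
        (p has_vector_derivative - D1 H (q t, p t)) (at t within {0..h}))"

text \<open>The time-\<open>h\<close> flow as a relation: a \<open>C\<^sup>1\<close> Hamiltonian alone does not make it single-valued.\<close>

definition flows_to ::
  "('n::finite phase \<Rightarrow> real) \<Rightarrow> 'n phase set \<Rightarrow> real \<Rightarrow> 'n phase \<Rightarrow> 'n phase \<Rightarrow> bool"
where
  "flows_to H P h z0 z1 \<longleftrightarrow>
     (\<exists>q p. hamilton_solution H P h q p \<and> (q 0, p 0) = z0 \<and> (q h, p h) = z1)"

definition bvp_solution ::
  "('n::finite phase \<Rightarrow> real) \<Rightarrow> 'n phase set \<Rightarrow> real \<Rightarrow> 'n phase \<Rightarrow>
     (real \<Rightarrow> real^'n) \<Rightarrow> (real \<Rightarrow> real^'n) \<Rightarrow> bool"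
where
  "bvp_solution H P h z q p \<longleftrightarrow> hamilton_solution H P h q p \<and> q 0 = fst z \<and> p h = snd z"

text \<open>
  Uniqueness is among curves staying in the patch \<open>P\<close> and, curves being total functions here,
  concerns only their values on \<open>[0, h]\<close>.
\<close>

definition bvp_uniquely_solvable ::
  "('n::finite phase \<Rightarrow> real) \<Rightarrow> 'n phase set \<Rightarrow> real \<Rightarrow> 'n phase \<Rightarrow> bool"
where
  "bvp_uniquely_solvable H P h z \<longleftrightarrow>
     (\<exists>q p. bvp_solution H P h z q p) \<and>
     (\<forall>q p q' p'. bvp_solution H P h z q p \<longrightarrow> bvp_solution H P h z q' p' \<longrightarrow>
        (\<forall>t\<in>{0..h}. q t = q' t \<and> p t = p' t))"

definition exact_right_hamiltonian ::
  "('n::finite phase \<Rightarrow> real) \<Rightarrow> 'n phase set \<Rightarrow> real \<Rightarrow> 'n phase \<Rightarrow> real"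
where
  "exact_right_hamiltonian H P h z =
     (THE s. \<exists>q p. bvp_solution H P h z q p \<and>
        s = snd z \<bullet> q h -
            integral {0..h}
              (\<lambda>t. p t \<bullet> vector_derivative q (at t within {0..h}) - H (q t, p t)))"

definition legendre_plus :: "(real \<Rightarrow> 'n::finite phase \<Rightarrow> real) \<Rightarrow> real \<Rightarrow> 'n phase \<Rightarrow> 'n phase" where
  "legendre_plus G h z = (D2 (G h) z, snd z)"

definition legendre_minus :: "(real \<Rightarrow> 'n::finite phase \<Rightarrow> real) \<Rightarrow> real \<Rightarrow> 'n phase \<Rightarrow> 'n phase" where
  "legendre_minus G h z = (fst z, D1 (G h) z)"

text \<open>
  Carrying \<open>h\<close> along makes regularity and invertibility of a family of maps joint in \<open>(z, h)\<close>, while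
  still being invertibility of each member of the family.
\<close>

definition with_step :: "(real \<Rightarrow> 'n::finite phase \<Rightarrow> 'n phase) \<Rightarrow> 'n phase \<times> real \<Rightarrow> 'n phase \<times> real" where
  "with_step F x = (F (snd x) (fst x), snd x)"

definition regularly_invertible ::
  "nat \<Rightarrow> (real \<Rightarrow> 'n::finite phase \<Rightarrow> 'n phase) \<Rightarrow> ('n phase \<times> real) set \<Rightarrow> bool"
where
  "regularly_invertible r F D \<longleftrightarrow>
     Ck_on r (with_step F) D \<and>
     inj_on (with_step F) D \<and>
     openin (top_of_set half_space) (with_step F ` D) \<and>
     Ck_on r (the_inv_into D (with_step F)) (with_step F ` D)"

definition regular_generating_function ::
  "nat \<Rightarrow> (real \<Rightarrow> 'n::finite phase \<Rightarrow> real) \<Rightarrow> ('n phase \<times> real) set \<Rightarrow> bool"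
where
  "regular_generating_function r G D \<longleftrightarrow>
     Ck_on r (\<lambda>x. G (snd x) (fst x)) D \<and>
     regularly_invertible r (legendre_plus G) D \<and>
     regularly_invertible r (legendre_minus G) D"

definition generated_map ::
  "(real \<Rightarrow> 'n::finite phase \<Rightarrow> real) \<Rightarrow> ('n phase \<times> real) set \<Rightarrow> real \<Rightarrow> 'n phase \<Rightarrow> 'n phase"
where
  "generated_map G D h z0 =
     (THE z1. ((fst z0, snd z1), h) \<in> D \<and>
        fst z1 = D2 (G h) (fst z0, snd z1) \<and>
        snd z0 = D1 (G h) (fst z0, snd z1))"

text \<open>
  The remainder \<open>e\<close> is only required for positive step sizes; its bounds are required on compact
  subsets of \<open>D\<close>, which may reach \<open>h = 0\<close>, and are thus uniform as \<open>h \<rightarrow> 0\<close>.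
\<close>

definition approximates_to_order ::
  "nat \<Rightarrow> ('n::finite phase \<times> real) set \<Rightarrow> (real \<Rightarrow> 'n phase \<Rightarrow> real) \<Rightarrow> (real \<Rightarrow> 'n phase \<Rightarrow> real) \<Rightarrow> bool"
where
  "approximates_to_order r D G G' \<longleftrightarrow>
     (let Dpos = {x \<in> D. snd x > 0} in
      \<exists>e e'. (\<forall>x\<in>Dpos. (e has_derivative e' x) (at x within Dpos)) \<and>
             (\<forall>v. continuous_on Dpos (\<lambda>x. e' x v)) \<and>
             (\<forall>K. compact K \<and> K \<subseteq> D \<longrightarrow>
                (\<exists>B. \<forall>x \<in> K \<inter> Dpos. \<bar>e x\<bar> \<le> B \<and> onorm (e' x) \<le> B)) \<and>
             (\<forall>(z, h) \<in> Dpos. G h z = G' h z + h ^ (r + 1) * e (z, h)))"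

text \<open>
  Order of accuracy on an open set \<open>U\<close> of initial values. It includes that, for step sizes small
  relative to the compact set of initial values, the flow is defined and single-valued.
\<close>

definition order_accurate ::
  "nat \<Rightarrow> ('n::finite phase \<Rightarrow> real) \<Rightarrow> 'n phase set \<Rightarrow> 'n phase set \<Rightarrow>
     (real \<Rightarrow> 'n phase \<Rightarrow> 'n phase) \<Rightarrow> bool"
where
  "order_accurate r H P U \<Phi> \<longleftrightarrow>
     (\<forall>K. compact K \<and> K \<subseteq> U \<longrightarrow>
        (\<exists>C. \<exists>h1>0. \<forall>h. 0 < h \<and> h \<le> h1 \<longrightarrow> (\<forall>z0\<in>K.
           \<exists>z1. (\<forall>w. flows_to H P h z0 w \<longleftrightarrow> w = z1) \<and> norm (\<Phi> h z0 - z1) \<le> C * h ^ (r + 1))))"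

end

theory Submission
  imports Defs
begin

text \<open>
  At \<open>h = 0\<close> both generating functions equal \<open>q \<bullet> p\<close>, so the Legendre transforms \<open>\<bbbF>\<^sup>-\<close> are the
  identity there; hence, for small \<open>h\<close>, both are inverted on a neighbourhood of a given compact set.
  The gradients of the two generating functions differ by \<open>O(h ^ (r + 1))\<close>. Given \<open>z\<^sub>0\<close>, let \<open>x\<close> and
  \<open>y\<close> be its preimages under the approximate and the exact \<open>\<bbbF>\<^sup>-\<close>. The exact \<open>\<bbbF>\<^sup>-\<close> maps \<open>x\<close> to a
  point within \<open>O(h ^ (r + 1))\<close> of \<open>z\<^sub>0\<close>, so local Lipschitz continuity of its inverse bounds
  \<open>x - y\<close>, and local Lipschitz continuity of the exact \<open>\<bbbF>\<^sup>+\<close> carries the bound over to the images.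
\<close>

section \<open>Maps of class C^k and Lipschitz bounds near compact sets\<close>

lemma Ck_on_imp_continuous_on: "Ck_on k f S \<Longrightarrow> continuous_on S f"
  by (cases k) (auto intro: has_derivative_continuous_on)

lemma Ck_on_imp_C1:
  assumes "Ck_on k f S" "k \<ge> 1"
  obtains f' where "\<And>x. x \<in> S \<Longrightarrow> (f has_derivative f' x) (at x within S)"
    "\<And>v. continuous_on S (\<lambda>x. f' x v)"
proof (cases k)
  case (Suc j)
  then obtain f' where "\<forall>x\<in>S. (f has_derivative f' x) (at x within S)" "\<forall>v. Ck_on j (\<lambda>x. f' x v) S"
    using assms by auto
  then show thesis
    using that Ck_on_imp_continuous_on by blast
qed (use assms in simp)

text \<open>Thickening is done relative to \<open>C\<close> because the compact sets of interest
  touch the boundary \<open>h = 0\<close> of the half-space, where no full neighbourhood is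
  available. The open ambient set \<open>T\<close> supplies the radius.\<close>

lemma compact_thickening_in_openin:
  fixes S :: "'a::euclidean_space set"
  assumes "openin (top_of_set C) S" "compact K" "K \<subseteq> S"
  obtains d where "d > 0" "\<And>x y. x \<in> K \<Longrightarrow> y \<in> C \<Longrightarrow> dist x y \<le> d \<Longrightarrow> y \<in> S"
proof -
  obtain T where T: "open T" "S = C \<inter> T"
    using assms(1) by (auto simp: openin_open)
  have "K \<subseteq> T"
    using assms(3) T by auto
  then obtain e where e: "e > 0" "(\<Union>x\<in>K. ball x e) \<subseteq> T"
    using compact_subset_open_imp_ball_epsilon_subset assms(2) T(1) by metis
  have "y \<in> S" if "x \<in> K" "y \<in> C" "dist x y \<le> e / 2" for x y
  proof -
    have "y \<in> ball x e"
      using that(3) e(1) by simp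
    then show ?thesis
      using that(1,2) e(2) T(2) by blast
  qed
  then show thesis
    using that[of "e / 2"] e(1) by simp
qed

text \<open>The derivative is bounded on a compact thickening of \<open>K\<close> inside
  \<open>C\<close>, and convexity of \<open>C\<close> keeps segments there, so the mean value
  inequality applies. Only \<open>x\<close> has to lie in \<open>K\<close>; this allows
  \<open>y\<close> to be a perturbed point about which little more than its distance to
  \<open>x\<close> is known.\<close>

lemma C1_lipschitz_near_compact:
  fixes f :: "'a::euclidean_space \<Rightarrow> 'b::real_normed_vector"
  assumes C: "convex C" "closed C" and S: "openin (top_of_set C) S"
    and K: "compact K" "K \<subseteq> S" and f: "Ck_on k f S" "k \<ge> 1"
  obtains d L where "d > 0" "L \<ge> 0"
    "\<And>x y. x \<in> K \<Longrightarrow> y \<in> C \<Longrightarrow> norm (y - x) \<le> d \<Longrightarrow> norm (f y - f x) \<le> L * norm (y - x)"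
proof -
  obtain f' where f': "\<And>x. x \<in> S \<Longrightarrow> (f has_derivative f' x) (at x within S)"
    "\<And>v. continuous_on S (\<lambda>x. f' x v)"
    using Ck_on_imp_C1[OF f] by blast
  obtain d where d: "d > 0" "\<And>x y. x \<in> K \<Longrightarrow> y \<in> C \<Longrightarrow> dist x y \<le> d \<Longrightarrow> y \<in> S"
    using compact_thickening_in_openin[OF S K] by blast
  \<comment> \<open>Writing the closed \<open>d\<close>-neighbourhood of \<open>K\<close> as a
    Minkowski sum of compact sets gives its compactness directly.\<close>
  define N where "N = {x + y |x y. x \<in> K \<and> y \<in> cball 0 d} \<inter> C"
  have N_iff: "y \<in> N \<longleftrightarrow> y \<in> C \<and> (\<exists>x\<in>K. dist x y \<le> d)" for y
  proof -
    have "(\<exists>x y'. y = x + y' \<and> x \<in> K \<and> y' \<in> cball 0 d) \<longleftrightarrow> (\<exists>x\<in>K. dist x y \<le> d)"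
    proof
      assume "\<exists>x\<in>K. dist x y \<le> d"
      then obtain x where "x \<in> K" "dist x y \<le> d"
        by blast
      then show "\<exists>x y'. y = x + y' \<and> x \<in> K \<and> y' \<in> cball 0 d"
        by (intro exI[of _ x] exI[of _ "y - x"]) (simp add: dist_norm norm_minus_commute)
    qed (force simp: dist_norm)
    then show ?thesis
      by (auto simp: N_def)
  qed
  have N: "compact N" "N \<subseteq> S"
    unfolding N_def
    by (intro compact_Int_closed compact_sums K(1) compact_cball C(2)) (use d(2) in \<open>force simp: dist_norm\<close>)
  have "\<exists>B. \<forall>x\<in>N. norm (f' x b) \<le> B" for b
    using compact_imp_bounded[OF compact_continuous_image[OF continuous_on_subset[OF f'(2) N(2)] N(1)]]
    by (auto simp: bounded_iff)
  then obtain B where B: "\<And>b x. x \<in> N \<Longrightarrow> norm (f' x b) \<le> B b"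
    by metis
  \<comment> \<open>Continuity of the derivative is known one direction at a time, so the operator
    norm is controlled by summing the bounds over basis vectors.\<close>
  define L where "L = (\<Sum>b\<in>Basis. \<bar>B b\<bar>)"
  have onorm: "onorm (f' x) \<le> L" if "x \<in> N" for x
  proof (rule onorm_le)
    fix v
    have lin: "linear (f' x)"
      using f'(1) that N(2) has_derivative_linear by blast
    have "norm (f' x v) = norm (\<Sum>b\<in>Basis. (v \<bullet> b) *\<^sub>R f' x b)"
      by (subst euclidean_representation[symmetric, of v])
        (simp only: linear_sum[OF lin] linear_scale[OF lin])
    also have "\<dots> \<le> (\<Sum>b\<in>Basis. \<bar>B b\<bar> * norm v)"
    proof (rule sum_norm_le)
      fix b :: 'a assume b: "b \<in> Basis"
      have "\<bar>v \<bullet> b\<bar> * norm (f' x b) \<le> norm v * \<bar>B b\<bar>"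
        using B[OF that, of b] Basis_le_norm[OF b, of v] by (intro mult_mono) auto
      then show "norm ((v \<bullet> b) *\<^sub>R f' x b) \<le> \<bar>B b\<bar> * norm v"
        by (simp add: mult.commute)
    qed
    finally show "norm (f' x v) \<le> L * norm v"
      by (simp add: L_def sum_distrib_right)
  qed
  have "norm (f y - f x) \<le> L * norm (y - x)" if "x \<in> K" "y \<in> C" "norm (y - x) \<le> d" for x y
  proof (rule differentiable_bound[where S = "cball x d \<inter> C" and f' = f'])
    have sub: "cball x d \<inter> C \<subseteq> N"
      using that(1) by (auto simp: N_iff)
    fix u assume u: "u \<in> cball x d \<inter> C"
    show "(f has_derivative f' u) (at u within cball x d \<inter> C)"
      using has_derivative_subset[OF f'(1)] u sub N(2) by blast
    show "onorm (f' u) \<le> L"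
      using onorm u sub by blast
  next
    show "x \<in> cball x d \<inter> C"
      using that K(2) S d(1) by (auto dest: openin_imp_subset)
  qed (use that C(1) in \<open>auto intro: convex_Int simp: dist_norm norm_minus_commute\<close>)
  moreover have "L \<ge> 0"
    by (simp add: L_def sum_nonneg)
  ultimately show thesis
    using that d(1) by blast
qed

section \<open>Gradients and their components in \<open>q\<close> and \<open>p\<close>\<close>

text \<open>Two gradients at a point induce the same linear form; testing it on their difference
  makes them equal, which justifies the definite description.\<close>

lemma gradient_eq:
  assumes "GDERIV f x :> g"
  shows "gradient f x = g"
proof -
  have "g' = g" if "GDERIV f x :> g'" for g'
  proof -
    have "(\<lambda>v. v \<bullet> g') = (\<lambda>v. v \<bullet> g)"
      using that assms has_derivative_unique unfolding gderiv_def by blast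
    from fun_cong[OF this, of "g' - g"] have "(g' - g) \<bullet> (g' - g) = 0"
      by (simp add: inner_diff_right)
    then show ?thesis
      by simp
  qed
  then show ?thesis
    unfolding gradient_def using assms by blast
qed

lemma has_derivative_imp_GDERIV:
  fixes f :: "'a::euclidean_space \<Rightarrow> real"
  assumes "(f has_derivative f') (at x)"
  obtains g where "GDERIV f x :> g" "\<And>v. f' v = v \<bullet> g"
proof -
  define g where "g = (\<Sum>b\<in>Basis. f' b *\<^sub>R b)"
  have lin: "linear f'"
    using assms has_derivative_linear by blast
  have f'_eq: "f' v = v \<bullet> g" for v
  proof -
    have "f' v = f' (\<Sum>b\<in>Basis. (v \<bullet> b) *\<^sub>R b)"
      by (simp add: euclidean_representation)
    also have "\<dots> = (\<Sum>b\<in>Basis. (v \<bullet> b) *\<^sub>R f' b)"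
      by (simp only: linear_sum[OF lin] linear_scale[OF lin])
    also have "\<dots> = v \<bullet> g"
      by (simp add: g_def inner_sum_right mult.commute)
    finally show ?thesis .
  qed
  then have "f' = (\<lambda>v. v \<bullet> g)"
    by auto
  then show thesis
    using that f'_eq assms by (auto simp: gderiv_def)
qed

text \<open>Chain rule along the affine inclusions that freeze one of the two variables. It reduces
  every statement about \<open>D1\<close> and \<open>D2\<close> to one about the total gradient in
  phase space.\<close>

lemma GDERIV_imp_partial_gradients:
  fixes F :: "'n::finite phase \<Rightarrow> real"
  assumes "GDERIV F z :> g"
  shows "D1 F z = fst g" "D2 F z = snd g"
proof -
  have F: "(F has_derivative (\<lambda>v. v \<bullet> g)) (at (fst z, snd z))"
    using assms by (simp add: gderiv_def)
  have "((\<lambda>q. F (q, snd z)) has_derivative (\<lambda>v. (v, 0) \<bullet> g)) (at (fst z))"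
    by (rule has_derivative_compose[of "\<lambda>q. (q, snd z)" "\<lambda>v. (v, 0)" _ _ F "\<lambda>v. v \<bullet> g"])
      (use F in \<open>auto intro!: derivative_eq_intros\<close>)
  then show "D1 F z = fst g"
    unfolding D1_def by (intro gradient_eq) (simp add: gderiv_def inner_prod_def)
  have "((\<lambda>p. F (fst z, p)) has_derivative (\<lambda>v. (0, v) \<bullet> g)) (at (snd z))"
    by (rule has_derivative_compose[of "\<lambda>p. (fst z, p)" "\<lambda>v. (0, v)" _ _ F "\<lambda>v. v \<bullet> g"])
      (use F in \<open>auto intro!: derivative_eq_intros\<close>)
  then show "D2 F z = snd g"
    unfolding D2_def by (intro gradient_eq) (simp add: gderiv_def inner_prod_def)
qed

section \<open>Restriction to a fixed step size, and neighbourhoods of \<open>h = 0\<close>\<close>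

lemma open_slice:
  fixes D :: "('n::finite phase \<times> real) set"
  assumes "openin (top_of_set half_space) D"
  shows "open {z. (z, h) \<in> D}"
proof -
  obtain T where T: "open T" "D = half_space \<inter> T"
    using assms by (auto simp: openin_open)
  have "open {z. (z, h) \<in> T}"
    using open_vimage[OF T(1), of "\<lambda>z. (z, h)"] by (simp add: vimage_def continuous_on_Pair)
  \<comment> \<open>A negative step size gives an empty slice, since \<open>D\<close> lies in the
    half-space.\<close>
  moreover have "{z. (z, h) \<in> D} = (if h \<ge> 0 then {z. (z, h) \<in> T} else {})"
    by (auto simp: T(2) half_space_def)
  ultimately show ?thesis
    by simp
qed

text \<open>Although derivatives within \<open>D\<close> may be one-sided in \<open>h\<close>, the
  slice at a fixed step is open, so the derivative in \<open>z\<close> is an ordinary one, even at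
  \<open>h = 0\<close>.\<close>

lemma has_derivative_slice:
  assumes f: "(f has_derivative f') (at (z, h) within D)"
    and D: "(z, h) \<in> D" "open {z. (z, h) \<in> D}"
  shows "((\<lambda>x. f (x, h)) has_derivative (\<lambda>v. f' (v, 0))) (at z)"
proof -
  have "(f has_derivative f') (at (z, h) within (\<lambda>x. (x, h)) ` {z. (z, h) \<in> D})"
    by (rule has_derivative_subset[OF f]) auto
  then have "((\<lambda>x. f (x, h)) has_derivative (\<lambda>v. f' (v, 0))) (at z within {z. (z, h) \<in> D})"
    by (rule has_derivative_in_compose[rotated]) (auto intro!: derivative_eq_intros)
  moreover have "at z within {z. (z, h) \<in> D} = at z"
    using D by (intro at_within_open) auto
  ultimately show ?thesis
    by (simp only:)
qed

text \<open>A tube lemma: it turns membership at \<open>h = 0\<close> into a range of step sizes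
  uniform over \<open>K\<close>.\<close>

lemma step_neighbourhood:
  fixes K :: "'n::finite phase set"
  assumes "openin (top_of_set half_space) W" "compact K" "\<And>z. z \<in> K \<Longrightarrow> (z, 0) \<in> W"
  obtains h0 where "h0 > 0" "K \<times> {0..h0} \<subseteq> W"
proof -
  have "compact (K \<times> {0::real})" "K \<times> {0} \<subseteq> W"
    using assms(2,3) by (auto intro: compact_Times)
  then obtain d where d: "d > 0"
    "\<And>x y. x \<in> K \<times> {0} \<Longrightarrow> y \<in> half_space \<Longrightarrow> dist x y \<le> d \<Longrightarrow> y \<in> W"
    using compact_thickening_in_openin[OF assms(1)] by blast
  have "(z, h) \<in> W" if "z \<in> K" "h \<in> {0..d}" for z h
    using d(2)[of "(z, 0)" "(z, h)"] that by (auto simp: dist_Pair_Pair half_space_def)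
  then show thesis
    using that[OF d(1)] by (metis mem_Sigma_iff subrelI)
qed

section \<open>Generating functions at step size zero\<close>

text \<open>On the degenerate interval the integral vanishes and the two boundary conditions refer
  to the same time, so only \<open>p \<bullet> q\<close> remains.\<close>

lemma exact_right_hamiltonian_0:
  assumes "bvp_uniquely_solvable H P 0 z"
  shows "exact_right_hamiltonian H P 0 z = fst z \<bullet> snd z"
proof -
  obtain q p where sol: "bvp_solution H P 0 z q p"
    using assms by (auto simp: bvp_uniquely_solvable_def)
  show ?thesis
    unfolding exact_right_hamiltonian_def
  proof (rule the_equality)
    show "\<exists>q p. bvp_solution H P 0 z q p \<and> fst z \<bullet> snd z = snd z \<bullet> q 0 -
        integral {0..0} (\<lambda>t. p t \<bullet> vector_derivative q (at t within {0..0}) - H (q t, p t))"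
      using sol by (intro exI[of _ q] exI[of _ p]) (simp add: bvp_solution_def inner_commute)
  qed (auto simp: bvp_solution_def inner_commute)
qed

lemma approximates_to_orderE:
  assumes "approximates_to_order r D G G'"
  obtains e e' where
    "\<forall>x\<in>D. snd x > 0 \<longrightarrow> (e has_derivative e' x) (at x within {x \<in> D. snd x > 0})"
    "\<forall>K. compact K \<and> K \<subseteq> D \<longrightarrow> (\<exists>B. \<forall>x\<in>K. snd x > 0 \<longrightarrow> \<bar>e x\<bar> \<le> B \<and> onorm (e' x) \<le> B)"
    "\<forall>z h. (z, h) \<in> D \<and> h > 0 \<longrightarrow> G h z = G' h z + h ^ (r + 1) * e (z, h)"
proof -
  obtain e e' where
    e1: "\<forall>x\<in>{x \<in> D. snd x > 0}. (e has_derivative e' x) (at x within {x \<in> D. snd x > 0})" and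
    e2: "\<forall>K. compact K \<and> K \<subseteq> D \<longrightarrow>
        (\<exists>B. \<forall>x\<in>K \<inter> {x \<in> D. snd x > 0}. \<bar>e x\<bar> \<le> B \<and> onorm (e' x) \<le> B)" and
    e3: "\<forall>(z, h)\<in>{x \<in> D. snd x > 0}. G h z = G' h z + h ^ (r + 1) * e (z, h)"
    using assms unfolding approximates_to_order_def Let_def by (elim exE conjE)
  show thesis
  proof (rule that)
    show "\<forall>K. compact K \<and> K \<subseteq> D \<longrightarrow> (\<exists>B. \<forall>x\<in>K. snd x > 0 \<longrightarrow> \<bar>e x\<bar> \<le> B \<and> onorm (e' x) \<le> B)"
    proof (intro allI impI)
      fix K assume K: "compact K \<and> K \<subseteq> D"
      with e2 obtain B where "\<forall>x\<in>K \<inter> {x \<in> D. snd x > 0}. \<bar>e x\<bar> \<le> B \<and> onorm (e' x) \<le> B"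
        by blast
      then show "\<exists>B. \<forall>x\<in>K. snd x > 0 \<longrightarrow> \<bar>e x\<bar> \<le> B \<and> onorm (e' x) \<le> B"
        using K by blast
    qed
  qed (use e1 e3 in auto)
qed

text \<open>The approximation relation speaks only of \<open>h > 0\<close>; equality at
  \<open>h = 0\<close> comes from continuity of both sides and a remainder bound that is uniform
  down to \<open>h = 0\<close>.\<close>

lemma approximates_to_order_imp_eq_0:
  fixes D :: "('n::finite phase \<times> real) set"
  assumes D: "openin (top_of_set half_space) D" "(z, 0) \<in> D"
    and G: "continuous_on D (\<lambda>x. G (snd x) (fst x))"
    and G': "continuous_on D (\<lambda>x. G' (snd x) (fst x))"
    and approx: "approximates_to_order r D G G'"
  shows "G 0 z = G' 0 z"
proof -
  obtain h0 where h0: "h0 > 0" "{z} \<times> {0..h0} \<subseteq> D"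
    using step_neighbourhood[OF D(1), of "{z}"] D(2) by auto
  obtain e and e' :: "'n phase \<times> real \<Rightarrow> 'n phase \<times> real \<Rightarrow> real" where e_bounded: "\<forall>K. compact K \<and> K \<subseteq> D \<longrightarrow>
      (\<exists>B. \<forall>x\<in>K. snd x > 0 \<longrightarrow> \<bar>e x\<bar> \<le> B \<and> onorm (e' x) \<le> B)"
    and G_eq: "\<forall>z h. (z, h) \<in> D \<and> h > 0 \<longrightarrow> G h z = G' h z + h ^ (r + 1) * e (z, h)"
    by (rule approximates_to_orderE[OF approx]) (rule that)
  have "compact ({z} \<times> {0..h0})"
    by (intro compact_Times) auto
  from e_bounded[rule_format, OF conjI, OF this h0(2)]
  obtain B where B: "\<forall>x\<in>{z} \<times> {0..h0}. snd x > 0 \<longrightarrow> \<bar>e x\<bar> \<le> B \<and> onorm (e' x) \<le> B"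
    by blast
  have bound: "\<bar>G h z - G' h z\<bar> \<le> h ^ (r + 1) * B" if "0 < h" "h \<le> h0" for h
  proof -
    have "(z, h) \<in> D"
      using that h0(2) by auto
    then have "G h z - G' h z = h ^ (r + 1) * e (z, h)"
      using G_eq[rule_format, of z h] that(1) by simp
    moreover have "\<bar>e (z, h)\<bar> \<le> B"
      using bspec[OF B, of "(z, h)"] that by simp
    ultimately show ?thesis
      using that(1) by (simp add: abs_mult mult_left_mono)
  qed
  have lim: "((\<lambda>h. F h z) \<longlongrightarrow> F 0 z) (at_right 0)"
    if "continuous_on D (\<lambda>x. F (snd x) (fst x))" for F :: "real \<Rightarrow> 'n phase \<Rightarrow> real"
  proof -
    have "continuous_on {0..h0} (\<lambda>h. F h z)"
      using continuous_on_compose2[OF that, of "{0..h0}" "\<lambda>h. (z, h)"] h0(2)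
      by (auto simp: continuous_on_Pair)
    then have "((\<lambda>h. F h z) \<longlongrightarrow> F 0 z) (at 0 within {0..h0})"
      using h0(1) by (auto simp: continuous_on_def)
    then show ?thesis
      using h0(1) by (simp add: at_within_Icc_at_right)
  qed
  have "((\<lambda>h. G h z - G' h z) \<longlongrightarrow> 0) (at_right 0)"
  proof (rule Lim_null_comparison)
    show "\<forall>\<^sub>F h in at_right 0. norm (G h z - G' h z) \<le> h ^ (r + 1) * B"
      using eventually_at_right_real[OF h0(1)]
      by eventually_elim (use bound in auto)
    show "((\<lambda>h. h ^ (r + 1) * B) \<longlongrightarrow> 0) (at_right 0)"
      by (auto intro!: tendsto_eq_intros)
  qed
  moreover have "((\<lambda>h. G h z - G' h z) \<longlongrightarrow> G 0 z - G' 0 z) (at_right 0)"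
    by (intro tendsto_diff lim G G')
  ultimately have "G 0 z - G' 0 z = 0"
    using tendsto_unique trivial_limit_at_right_real by blast
  then show ?thesis
    by simp
qed

lemma legendre_minus_inner:
  fixes G :: "real \<Rightarrow> 'n::finite phase \<Rightarrow> real"
  assumes "open V" "z \<in> V" "\<And>x. x \<in> V \<Longrightarrow> G h x = fst x \<bullet> snd x"
  shows "legendre_minus G h z = z"
proof -
  \<comment> \<open>The gradient of the pairing swaps the components, so its \<open>q\<close>-part
    returns the momentum and the minus Legendre transform is the identity.\<close>
  have "((\<lambda>x. fst x \<bullet> snd x) has_derivative (\<lambda>v. v \<bullet> (snd z, fst z))) (at z)"
    by (auto intro!: derivative_eq_intros simp: inner_prod_def inner_commute)
  then have "GDERIV (G h) z :> (snd z, fst z)"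
    unfolding gderiv_def
    by (rule has_derivative_transform_within_open[OF _ assms(1,2)]) (simp add: assms(3))
  then show ?thesis
    by (simp add: legendre_minus_def GDERIV_imp_partial_gradients(1))
qed

section \<open>Comparison of the Legendre transforms of two generating functions\<close>

lemma regular_generating_function_GDERIV:
  fixes D :: "('n::finite phase \<times> real) set"
  assumes "regular_generating_function r G D" "r \<ge> 1" "openin (top_of_set half_space) D" "(z, h) \<in> D"
  shows "GDERIV (G h) z :> (D1 (G h) z, D2 (G h) z)"
proof -
  have "Ck_on r (\<lambda>x. G (snd x) (fst x)) D"
    using assms(1) by (simp add: regular_generating_function_def)
  then obtain G' where
    "\<And>x. x \<in> D \<Longrightarrow> ((\<lambda>x. G (snd x) (fst x)) has_derivative G' x) (at x within D)"
    "\<And>v. continuous_on D (\<lambda>x. G' x v)"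
    using Ck_on_imp_C1[OF _ assms(2)] by blast
  from has_derivative_slice[OF this(1)[OF assms(4)] assms(4) open_slice[OF assms(3)]]
  have "(G h has_derivative (\<lambda>v. G' (z, h) (v, 0))) (at z)"
    by simp
  then obtain g where g: "GDERIV (G h) z :> g"
    using has_derivative_imp_GDERIV by blast
  then show ?thesis
    using GDERIV_imp_partial_gradients[OF g] by simp
qed

text \<open>Differentiate \<open>G = G' + h ^ (r + 1) * e\<close> in \<open>z\<close> with
  \<open>h\<close> frozen. The power of \<open>h\<close> is a constant for this derivative, so no
  order is lost, and the \<open>z\<close>-gradient of \<open>e\<close> is bounded on compact
  sets.\<close>

lemma approximates_to_order_legendre_bounds:
  fixes D :: "('n::finite phase \<times> real) set"
  assumes r: "r \<ge> 1" and D: "openin (top_of_set half_space) D"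
    and G: "regular_generating_function r G D" and G': "regular_generating_function r G' D"
    and approx: "approximates_to_order r D G G'"
    and K: "compact K" "K \<subseteq> D"
  obtains B where "B \<ge> 0"
    "\<And>z h. (z, h) \<in> K \<Longrightarrow> h > 0 \<Longrightarrow> norm (legendre_minus G h z - legendre_minus G' h z) \<le> B * h ^ (r + 1)"
    "\<And>z h. (z, h) \<in> K \<Longrightarrow> h > 0 \<Longrightarrow> norm (legendre_plus G h z - legendre_plus G' h z) \<le> B * h ^ (r + 1)"
proof -
  define Dpos where "Dpos = {x \<in> D. snd x > 0}"
  obtain e e' where e: "\<forall>x\<in>D. snd x > 0 \<longrightarrow> (e has_derivative e' x) (at x within Dpos)"
    "\<forall>K. compact K \<and> K \<subseteq> D \<longrightarrow> (\<exists>B. \<forall>x\<in>K. snd x > 0 \<longrightarrow> \<bar>e x\<bar> \<le> B \<and> onorm (e' x) \<le> B)"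
    "\<forall>z h. (z, h) \<in> D \<and> h > 0 \<longrightarrow> G h z = G' h z + h ^ (r + 1) * e (z, h)"
    by (rule approximates_to_orderE[OF approx, folded Dpos_def]) (rule that)
  from e(2)[rule_format, OF conjI, OF K]
  obtain B where B: "\<forall>x\<in>K. snd x > 0 \<longrightarrow> \<bar>e x\<bar> \<le> B \<and> onorm (e' x) \<le> B"
    by (elim exE)
  \<comment> \<open>\<open>B\<close> could be negative when \<open>K\<close> has no point with
    positive step, hence the absolute value.\<close>
  have bound: "norm ((D1 (G h) z, D2 (G h) z) - (D1 (G' h) z, D2 (G' h) z)) \<le> \<bar>B\<bar> * h ^ (r + 1)"
    if zh: "(z, h) \<in> K" "h > 0" for z h
  proof -
    have in_D: "(z, h) \<in> D" "(z, h) \<in> Dpos"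
      using zh K(2) by (auto simp: Dpos_def)
    have slice: "open {z. (z, h) \<in> Dpos}"
      using open_slice[OF D, of h] zh(2) by (simp add: Dpos_def)
    have e': "(e has_derivative e' (z, h)) (at (z, h) within Dpos)"
      using e(1) in_D(1) zh(2) by simp
    obtain g where g: "GDERIV (\<lambda>x. e (x, h)) z :> g" "\<And>v. e' (z, h) (v, 0) = v \<bullet> g"
      using has_derivative_imp_GDERIV[OF has_derivative_slice[OF e' in_D(2) slice]] by blast
    \<comment> \<open>Applying the joint derivative of \<open>e\<close> to its own
      \<open>z\<close>-gradient \<open>g\<close>, with no motion in \<open>h\<close>, bounds the
      square of \<open>norm g\<close> by \<open>\<bar>B\<bar> * norm g\<close>; one factor then
      cancels.\<close>
    have "norm g ^ 2 = e' (z, h) (g, 0)"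
      by (simp add: g(2) power2_norm_eq_inner)
    also have "\<dots> \<le> onorm (e' (z, h)) * norm (g, 0::real)"
      using onorm[OF has_derivative_bounded_linear[OF e'], of "(g, 0)"] by simp
    also have "\<dots> \<le> \<bar>B\<bar> * norm g"
      using bspec[OF B zh(1)] zh(2) by (auto simp: norm_Pair intro!: mult_right_mono)
    finally have norm_g: "norm g \<le> \<bar>B\<bar>"
      by (cases "norm g = 0") (auto simp: power2_eq_square)
    define \<gamma> where "\<gamma> = (D1 (G' h) z, D2 (G' h) z)"
    have "(G' h has_derivative (\<lambda>v. v \<bullet> \<gamma>)) (at z)" "((\<lambda>x. e (x, h)) has_derivative (\<lambda>v. v \<bullet> g)) (at z)"
      using regular_generating_function_GDERIV[OF G' r D in_D(1)] g(1)
      by (simp_all add: gderiv_def \<gamma>_def)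
    then have "((\<lambda>x. G' h x + h ^ (r + 1) * e (x, h)) has_derivative (\<lambda>v. v \<bullet> (\<gamma> + h ^ (r + 1) *\<^sub>R g))) (at z)"
      by (auto intro!: derivative_eq_intros simp: inner_add_right)
    then have "GDERIV (G h) z :> \<gamma> + h ^ (r + 1) *\<^sub>R g"
      unfolding gderiv_def
      by (rule has_derivative_transform_within_open[OF _ slice]) (use in_D(2) in \<open>auto simp: Dpos_def e(3)[rule_format]\<close>)
    from GDERIV_imp_partial_gradients[OF this]
    have "(D1 (G h) z, D2 (G h) z) - \<gamma> = h ^ (r + 1) *\<^sub>R g"
      by (simp add: prod_eq_iff)
    moreover have "norm (h ^ (r + 1) *\<^sub>R g) \<le> \<bar>B\<bar> * h ^ (r + 1)"
      using norm_g zh(2) by (simp add: mult.commute mult_left_mono)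
    ultimately show ?thesis
      by (simp add: \<gamma>_def)
  qed
  \<comment> \<open>Each Legendre transform copies one component of \<open>z\<close>, so a
    difference of transforms shows only one of the two partial gradients.\<close>
  have le: "norm (legendre_minus G h z - legendre_minus G' h z) \<le> norm ((D1 (G h) z, D2 (G h) z) - (D1 (G' h) z, D2 (G' h) z))"
    "norm (legendre_plus G h z - legendre_plus G' h z) \<le> norm ((D1 (G h) z, D2 (G h) z) - (D1 (G' h) z, D2 (G' h) z))" for z h
    by (simp_all add: legendre_minus_def legendre_plus_def norm_Pair real_sqrt_le_mono)
  show thesis
    using that[of "\<bar>B\<bar>"] order_trans[OF le(1) bound] order_trans[OF le(2) bound] by simp
qed

section \<open>The generated map through Legendre transforms\<close>

text \<open>This is the factorization into the plus transform after the inverse minus transform. Any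
  solution \<open>z1\<close> of the implicit equations yields a preimage
  \<open>(fst z, snd z1)\<close> of \<open>z\<close>, so injectivity makes the definite description
  meaningful.\<close>

lemma generated_map_legendre_minus:
  assumes "inj_on (with_step (legendre_minus G)) D" "(x, h) \<in> D" "z = legendre_minus G h x"
  shows "generated_map G D h z = legendre_plus G h x"
  unfolding generated_map_def
proof (rule the_equality)
  show "((fst z, snd (legendre_plus G h x)), h) \<in> D \<and>
    fst (legendre_plus G h x) = D2 (G h) (fst z, snd (legendre_plus G h x)) \<and>
    snd z = D1 (G h) (fst z, snd (legendre_plus G h x))"
    using assms(2,3) by (simp add: legendre_minus_def legendre_plus_def)
next
  fix z1 assume z1: "((fst z, snd z1), h) \<in> D \<and> fst z1 = D2 (G h) (fst z, snd z1) \<and>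
    snd z = D1 (G h) (fst z, snd z1)"
  then have "with_step (legendre_minus G) ((fst z, snd z1), h) = with_step (legendre_minus G) (x, h)"
    using assms(3) by (auto simp: with_step_def legendre_minus_def prod_eq_iff)
  then have "(fst z, snd z1) = x"
    using inj_onD[OF assms(1)] z1 assms(2) by blast
  then show "z1 = legendre_plus G h x"
    using z1 by (auto simp: legendre_plus_def prod_eq_iff)
qed

lemma the_inv_into_with_step:
  assumes "inj_on (with_step F) D" "(z, h) \<in> with_step F ` D"
  obtains x where "the_inv_into D (with_step F) (z, h) = (x, h)" "(x, h) \<in> D" "F h x = z"
proof -
  obtain x where x: "(x, h) \<in> D" "F h x = z"
    using assms(2) by (auto simp: with_step_def)
  then have "with_step F (x, h) = (z, h)"
    by (simp add: with_step_def)
  then have "the_inv_into D (with_step F) (z, h) = (x, h)"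
    using the_inv_into_f_f[OF assms(1) x(1)] by simp
  then show thesis
    using that x by blast
qed

section \<open>The order estimate\<close>

theorem theorem2:
  fixes H :: "'n::finite phase \<Rightarrow> real"
    and Hd :: "real \<Rightarrow> 'n phase \<Rightarrow> real"
    and P :: "'n phase set"
    and D :: "('n phase \<times> real) set"
    and r :: nat
  assumes "r \<ge> 1"
    and "open P"
    and "Ck_on 1 H P"
    and "openin (top_of_set half_space) D"
    and "\<And>z h. (z, h) \<in> D \<Longrightarrow> bvp_uniquely_solvable H P h z"
    and exact_regular: "regular_generating_function r (exact_right_hamiltonian H P) D"
    and exact_flow: "\<And>z0 z1 h. (z0, h) \<in> with_step (legendre_minus (exact_right_hamiltonian H P)) ` D \<Longrightarrow>
           flows_to H P h z0 z1 \<longleftrightarrow> z1 = generated_map (exact_right_hamiltonian H P) D h z0"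
    and regular: "regular_generating_function r Hd D"
    and approximation: "approximates_to_order r D Hd (exact_right_hamiltonian H P)"
  shows "order_accurate r H P {z. (z, 0) \<in> D} (generated_map Hd D)"
  unfolding order_accurate_def
proof (intro allI impI, elim conjE)
  fix K :: "'n phase set"
  assume K: "compact K" "K \<subseteq> {z. (z, 0) \<in> D}"
  note D = \<open>openin (top_of_set half_space) D\<close>
  define E where "E = exact_right_hamiltonian H P"
  define m where "m G = with_step (legendre_minus G)" for G :: "real \<Rightarrow> 'n phase \<Rightarrow> real"
  define inv_m where "inv_m G = the_inv_into D (m G)" for G
  note E_regular = exact_regular[folded E_def] and approx = approximation[folded E_def]
  note defs = regular_generating_function_def regularly_invertible_def m_def[symmetric] inv_m_def[symmetric]
  have m_inj: "inj_on (m G) D" and m_open: "openin (top_of_set half_space) (m G ` D)"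
    and inv_m: "Ck_on r (inv_m G) (m G ` D)" and G_cont: "continuous_on D (\<lambda>x. G (snd x) (fst x))"
    if "regular_generating_function r G D" for G
    using that Ck_on_imp_continuous_on unfolding defs by auto
  have half_space: "convex (half_space :: ('n phase \<times> real) set)" "closed (half_space :: ('n phase \<times> real) set)"
    by (auto simp: half_space_def intro: convex_Times closed_Times)
  have E_0: "E 0 z = fst z \<bullet> snd z" if "(z, 0) \<in> D" for z
    using that assms(5) by (simp add: E_def exact_right_hamiltonian_0)
  have Hd_0: "Hd 0 z = fst z \<bullet> snd z" if "(z, 0) \<in> D" for z
    using approximates_to_order_imp_eq_0[OF D that G_cont[OF regular] G_cont[OF E_regular] approx]
      E_0[OF that] by simp
  have K_img: "(z, 0) \<in> m G ` D"
    if "z \<in> K" and "\<And>z. (z, 0) \<in> D \<Longrightarrow> G 0 z = fst z \<bullet> snd z" for G z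
  proof -
    have "legendre_minus G 0 z = z"
      using legendre_minus_inner[OF open_slice[OF D, of 0], of z G 0] that K(2) by auto
    then show ?thesis
      using that(1) K(2) by (intro image_eqI[of _ _ "(z, 0)"]) (auto simp: m_def with_step_def)
  qed
  \<comment> \<open>Both minus transforms fix \<open>K\<close> at \<open>h = 0\<close>, so the
    common part of their images is a relatively open set around \<open>K \<times> {0}\<close>, and
    one \<open>h0\<close> serves both.\<close>
  have "openin (top_of_set half_space) (m E ` D \<inter> m Hd ` D)"
    using m_open E_regular regular by blast
  moreover have "(z, 0) \<in> m E ` D \<inter> m Hd ` D" if "z \<in> K" for z
    using K_img[of z E] K_img[of z Hd] E_0 Hd_0 that by auto
  ultimately obtain h0 where h0: "h0 > 0" "K \<times> {0..h0} \<subseteq> m E ` D \<inter> m Hd ` D"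
    using step_neighbourhood[OF _ K(1)] by metis
  define A where "A = K \<times> {0..h0}"
  have A: "compact A" "A \<subseteq> m E ` D" "A \<subseteq> m Hd ` D"
    using h0(2) K(1) by (auto simp: A_def intro: compact_Times)
  have img: "compact (inv_m G ` A)" "inv_m G ` A \<subseteq> D"
    if "regular_generating_function r G D" "A \<subseteq> m G ` D" for G
  proof -
    show "compact (inv_m G ` A)"
      using compact_continuous_image[OF continuous_on_subset[OF Ck_on_imp_continuous_on[OF inv_m]]]
        that A(1) by blast
    show "inv_m G ` A \<subseteq> D"
      unfolding inv_m_def using that(2) the_inv_into_into[OF m_inj[OF that(1)] _ subset_refl] by blast
  qed
  \<comment> \<open>The two generating functions are compared at preimages under the approximate
    transform, because that is where \<open>x\<close> will lie; the Lipschitz bounds below concern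
    the exact one.\<close>
  obtain B where B: "B \<ge> 0"
    "\<And>z h. (z, h) \<in> inv_m Hd ` A \<Longrightarrow> h > 0 \<Longrightarrow> norm (legendre_minus Hd h z - legendre_minus E h z) \<le> B * h ^ (r + 1)"
    "\<And>z h. (z, h) \<in> inv_m Hd ` A \<Longrightarrow> h > 0 \<Longrightarrow> norm (legendre_plus Hd h z - legendre_plus E h z) \<le> B * h ^ (r + 1)"
    using approximates_to_order_legendre_bounds[OF \<open>r \<ge> 1\<close> D regular E_regular approx img[OF regular A(3)]]
    by blast
  obtain d1 L1 where L1: "d1 > 0" "L1 \<ge> 0"
    "\<And>x y. x \<in> A \<Longrightarrow> y \<in> half_space \<Longrightarrow> norm (y - x) \<le> d1 \<Longrightarrow> norm (inv_m E y - inv_m E x) \<le> L1 * norm (y - x)"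
    using C1_lipschitz_near_compact[OF half_space m_open[OF E_regular] A(1,2) inv_m[OF E_regular] \<open>r \<ge> 1\<close>]
    by blast
  have "Ck_on r (with_step (legendre_plus E)) D"
    using E_regular unfolding defs by blast
  then obtain d2 L2 where L2: "d2 > 0" "L2 \<ge> 0"
    "\<And>x y. x \<in> inv_m E ` A \<Longrightarrow> y \<in> half_space \<Longrightarrow> norm (y - x) \<le> d2 \<Longrightarrow>
      norm (with_step (legendre_plus E) y - with_step (legendre_plus E) x) \<le> L2 * norm (y - x)"
    using C1_lipschitz_near_compact[OF half_space D img[OF E_regular A(2)] _ \<open>r \<ge> 1\<close>] by blast
  \<comment> \<open>The cap by \<open>1\<close> gives \<open>h ^ (r + 1) \<le> h\<close>; the
    quotients then keep both perturbations within the radii \<open>d1\<close> and \<open>d2\<close>.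
    Adding \<open>1\<close> keeps the denominators positive.\<close>
  define h1 where "h1 = min (min h0 1) (min (d1 / (B + 1)) (d2 / (L1 * B + 1)))"
  have pos: "B + 1 > 0" "L1 * B + 1 > 0"
    using B(1) L1(2) by (auto intro: add_nonneg_pos)
  have h1: "h1 > 0"
    using h0(1) L1(1) L2(1) pos by (simp add: h1_def)
  \<comment> \<open>The summand \<open>B\<close> is the gap between the two plus transforms at
    \<open>x\<close>; \<open>L2 * (L1 * B)\<close> is the cost of moving from \<open>x\<close> to
    \<open>y\<close> under the exact one.\<close>
  have "\<exists>z1. (\<forall>w. flows_to H P h z0 w \<longleftrightarrow> w = z1) \<and>
      norm (generated_map Hd D h z0 - z1) \<le> (B + L2 * (L1 * B)) * h ^ (r + 1)"
    if h: "0 < h" "h \<le> h1" and z0: "z0 \<in> K" for h z0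
  proof -
    have zA: "(z0, h) \<in> A"
      using h z0 by (auto simp: A_def h1_def)
    obtain x where x: "inv_m Hd (z0, h) = (x, h)" "(x, h) \<in> D" "legendre_minus Hd h x = z0"
      using the_inv_into_with_step[OF m_inj[OF regular, unfolded m_def]] zA A(3)
      unfolding inv_m_def m_def by blast
    obtain y where y: "inv_m E (z0, h) = (y, h)" "(y, h) \<in> D" "legendre_minus E h y = z0"
      using the_inv_into_with_step[OF m_inj[OF E_regular, unfolded m_def]] zA A(2)
      unfolding inv_m_def m_def by blast
    have xA: "(x, h) \<in> inv_m Hd ` A" and yA: "(y, h) \<in> inv_m E ` A"
      using zA x(1) y(1) by (metis image_eqI)+
    define \<epsilon> where "\<epsilon> = h ^ (r + 1)"
    have \<epsilon>: "0 \<le> \<epsilon>" "\<epsilon> \<le> h"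
      using h power_decreasing[of 1 "r + 1" h] by (auto simp: \<epsilon>_def h1_def)
    have "(B + 1) * h \<le> d1" "(L1 * B + 1) * h \<le> d2"
      using h(2) pos by (simp_all add: h1_def pos_le_divide_eq mult.commute[of h])
    then have "(B + 1) * \<epsilon> \<le> d1" "(L1 * B + 1) * \<epsilon> \<le> d2"
      using mult_left_mono[OF \<epsilon>(2) less_imp_le[OF pos(1)]] mult_left_mono[OF \<epsilon>(2) less_imp_le[OF pos(2)]]
      by linarith+
    then have small: "B * \<epsilon> \<le> d1" "L1 * (B * \<epsilon>) \<le> d2"
      using \<epsilon>(1) by (auto simp: algebra_simps)
    have mx: "m E (x, h) = (legendre_minus E h x, h)"
      by (simp add: m_def with_step_def)
    have "norm (m E (x, h) - (z0, h)) = norm (legendre_minus Hd h x - legendre_minus E h x)"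
      unfolding mx by (simp add: x(3) norm_Pair norm_minus_commute)
    then have close: "norm (m E (x, h) - (z0, h)) \<le> B * \<epsilon>"
      using B(2)[OF xA h(1)] by (simp add: \<epsilon>_def)
    have "m E (x, h) \<in> half_space"
      using h(1) by (simp add: mx half_space_def)
    \<comment> \<open>Only the endpoint \<open>(z0, h)\<close> is known to lie in \<open>A\<close>;
      closeness within \<open>d1\<close> suffices for the other one.\<close>
    then have "norm (inv_m E (m E (x, h)) - inv_m E (z0, h)) \<le> L1 * norm (m E (x, h) - (z0, h))"
      using L1(3)[OF zA, of "m E (x, h)"] close small(1) by linarith
    also have "\<dots> \<le> L1 * (B * \<epsilon>)"
      using close L1(2) by (rule mult_left_mono)
    also have "inv_m E (m E (x, h)) = (x, h)"
      unfolding inv_m_def by (rule the_inv_into_f_f[OF m_inj[OF E_regular] x(2)])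
    finally have xy: "norm ((x, h) - (y, h)) \<le> L1 * (B * \<epsilon>)"
      by (simp add: y(1))
    have "(x, h) \<in> half_space"
      using h(1) by (simp add: half_space_def)
    then have "norm (with_step (legendre_plus E) (x, h) - with_step (legendre_plus E) (y, h)) \<le> L2 * norm ((x, h) - (y, h))"
      using L2(3)[OF yA, of "(x, h)"] xy small(2) by linarith
    also have "\<dots> \<le> L2 * (L1 * (B * \<epsilon>))"
      using xy L2(2) by (rule mult_left_mono)
    finally have "norm (legendre_plus E h x - legendre_plus E h y) \<le> L2 * (L1 * (B * \<epsilon>))"
      by (simp add: with_step_def norm_Pair)
    moreover have "norm (legendre_plus Hd h x - legendre_plus E h x) \<le> B * \<epsilon>"
      using B(3)[OF xA h(1)] by (simp add: \<epsilon>_def)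
    ultimately have "norm (legendre_plus Hd h x - legendre_plus E h y) \<le> B * \<epsilon> + L2 * (L1 * (B * \<epsilon>))"
      using norm_diff_triangle_le by (metis add.commute)
    moreover have "generated_map Hd D h z0 = legendre_plus Hd h x"
      using generated_map_legendre_minus m_inj[OF regular] x unfolding m_def by metis
    moreover have "generated_map E D h z0 = legendre_plus E h y"
      using generated_map_legendre_minus m_inj[OF E_regular] y unfolding m_def by metis
    \<comment> \<open>As \<open>(z0, h)\<close> lies in the image of the exact minus transform,
      \<open>exact_flow\<close> gives existence and uniqueness of the flow value together with its
      identification.\<close>
    moreover have "\<forall>w. flows_to H P h z0 w \<longleftrightarrow> w = generated_map E D h z0"
      using exact_flow zA A(2) unfolding E_def m_def by blast
    ultimately show ?thesis
      unfolding \<epsilon>_def by (intro exI[of _ "generated_map E D h z0"]) (simp add: algebra_simps)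
  qed
  then show "\<exists>C. \<exists>h1>0. \<forall>h. 0 < h \<and> h \<le> h1 \<longrightarrow> (\<forall>z0\<in>K.
      \<exists>z1. (\<forall>w. flows_to H P h z0 w \<longleftrightarrow> w = z1) \<and> norm (generated_map Hd D h z0 - z1) \<le> C * h ^ (r + 1))"
    using h1 by blast
qed

end
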